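(* Suppose that $n>2$ and that $\Lambda_1,\ldots,\Lambda_{n-1}$ are mutually orthogonal Latin squares of order $n$ with pairwise disjoint sets of symbols $\mathcal{L}_1,\ldots,\mathcal{L}_{n-1}$. Then the $(n+1)\times(n+1)$ array $\bar{S}$ constructed from them (as defined in the context) is a uniform $((n+1)\times(n+1))/((n-2)n)$ semi-Latin square, in which every two blocks not in the same row or column have exactly $n-2$ treatments in common.
   Context: For integers $m>2$ and $k>0$, an $(m\times m)/k$ semi-Latin square is an $m\times m$ array of $k$-subsets (called blocks) of an $mk$-set (of treatments), such that each treatment occurs once in each row and once in each column of the array. It is uniform if every pair of blocks, not in the same row or column, intersect in the same positive number $\mu$ of treatments. Construction of $\bar{S}$. For $i=1,\ldots,n-2$ and $j=1,\ldots,n$, put $\mathcal{L}_{ij}=\{(\alpha,j):\alpha\in\mathcal{L}_i\}$ and $\bar{\mathcal{L}}_i=\mathcal{L}_{i1}\cup\cdots\cup\mathcal{L}_{in}$. Let $\bar{\Lambda}_i$ be the $n$-fold inflation of $\Lambda_i$ using the symbols in $\bar{\mathcal{L}}_i$ (each symbol $\alpha$ is replaced by the $n$ symbols $(\alpha,1),\ldots,(\alpha,n)$). Put $\bar{\mathcal{L}}_{n-1}=\mathcal{L}_{n-1}\times\{1,\ldots,n-2\}$ and let $\bar{\Lambda}_{n-1}$ be the $(n-2)$-fold inflation of $\Lambda_{n-1}$ using the symbols in $\bar{\mathcal{L}}_{n-1}$ (each $\alpha$ is replaced by $(\alpha,1),\ldots,(\alpha,n-2)$). Superpose $\bar{\Lambda}_1,\ldots,\bar{\Lambda}_{n-1}$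 (take cellwise unions) to obtain an $(n\times n)/((n-2)(n+1))$ semi-Latin square. Add an extra (initially empty) row and column, numbered $n+1$. For $i,j\in\{1,\ldots,n\}$ and $t=1,\ldots,n-2$, the cell $(i,j)$ contains a unique symbol from $\mathcal{L}_{tj}$: remove this symbol from cell $(i,j)$ and insert it in cells $(i,n+1)$ and $(n+1,j)$. Finally put all the symbols in $\bar{\mathcal{L}}_{n-1}$ into cell $(n+1,n+1)$. The resulting $(n+1)\times(n+1)$ array is $\bar{S}$. *)

theory Defs
  imports "HOL-Library.Disjoint_Sets"
begin

text \<open>
  An array is a function of a row and a column number; rows and columns are numbered from 1,
  and only the values at in-range positions matter.
\<close>

definition latin_square :: "nat \<Rightarrow> 'a set \<Rightarrow> (nat \<Rightarrow> nat \<Rightarrow> 'a) \<Rightarrow> bool" where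
  "latin_square n X A \<longleftrightarrow>
     finite X \<and> card X = n \<and>
     (\<forall>r\<in>{1..n}. \<forall>c\<in>{1..n}. A r c \<in> X) \<and>
     (\<forall>x\<in>X. \<forall>r\<in>{1..n}. \<exists>!c. c \<in> {1..n} \<and> A r c = x) \<and>
     (\<forall>x\<in>X. \<forall>c\<in>{1..n}. \<exists>!r. r \<in> {1..n} \<and> A r c = x)"

definition orthogonal_squares ::
  "nat \<Rightarrow> 'a set \<Rightarrow> 'b set \<Rightarrow> (nat \<Rightarrow> nat \<Rightarrow> 'a) \<Rightarrow> (nat \<Rightarrow> nat \<Rightarrow> 'b) \<Rightarrow> bool" where
  "orthogonal_squares n X Y A B \<longleftrightarrow>
     (\<forall>x\<in>X. \<forall>y\<in>Y. \<exists>!p. p \<in> {1..n} \<times> {1..n} \<and> A (fst p) (snd p) = x \<and> B (fst p) (snd p) = y)"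

definition mutually_orthogonal_latin_squares ::
  "nat \<Rightarrow> 'i set \<Rightarrow> ('i \<Rightarrow> 'a set) \<Rightarrow> ('i \<Rightarrow> nat \<Rightarrow> nat \<Rightarrow> 'a) \<Rightarrow> bool" where
  "mutually_orthogonal_latin_squares n I L \<Lambda> \<longleftrightarrow>
     (\<forall>i\<in>I. latin_square n (L i) (\<Lambda> i)) \<and>
     (\<forall>i\<in>I. \<forall>j\<in>I. i \<noteq> j \<longrightarrow> orthogonal_squares n (L i) (L j) (\<Lambda> i) (\<Lambda> j))"

text \<open>\<open>semi_latin_square m k T B\<close>: \<open>B\<close> is an $(m \times m)/k$ semi-Latin square with treatment set \<open>T\<close>.\<close>

definition semi_latin_square ::
  "nat \<Rightarrow> nat \<Rightarrow> 'a set \<Rightarrow> (nat \<Rightarrow> nat \<Rightarrow> 'a set) \<Rightarrow> bool" where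
  "semi_latin_square m k T B \<longleftrightarrow>
     m > 2 \<and> k > 0 \<and> finite T \<and> card T = m * k \<and>
     (\<forall>r\<in>{1..m}. \<forall>c\<in>{1..m}. B r c \<subseteq> T \<and> card (B r c) = k) \<and>
     (\<forall>x\<in>T. \<forall>r\<in>{1..m}. \<exists>!c. c \<in> {1..m} \<and> x \<in> B r c) \<and>
     (\<forall>x\<in>T. \<forall>c\<in>{1..m}. \<exists>!r. r \<in> {1..m} \<and> x \<in> B r c)"

definition blocks_meet_in :: "nat \<Rightarrow> nat \<Rightarrow> (nat \<Rightarrow> nat \<Rightarrow> 'a set) \<Rightarrow> bool" where
  "blocks_meet_in m \<mu> B \<longleftrightarrow>
     (\<forall>r\<in>{1..m}. \<forall>c\<in>{1..m}. \<forall>r'\<in>{1..m}. \<forall>c'\<in>{1..m}.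
        r \<noteq> r' \<and> c \<noteq> c' \<longrightarrow> card (B r c \<inter> B r' c') = \<mu>)"

definition uniform_semi_latin_square ::
  "nat \<Rightarrow> nat \<Rightarrow> 'a set \<Rightarrow> (nat \<Rightarrow> nat \<Rightarrow> 'a set) \<Rightarrow> bool" where
  "uniform_semi_latin_square m k T B \<longleftrightarrow>
     semi_latin_square m k T B \<and> (\<exists>\<mu>>0. blocks_meet_in m \<mu> B)"

definition inflation :: "nat \<Rightarrow> (nat \<Rightarrow> nat \<Rightarrow> 'a) \<Rightarrow> nat \<Rightarrow> nat \<Rightarrow> ('a \<times> nat) set" where
  "inflation s A r c = {(A r c, l) | l. l \<in> {1..s}}"

text \<open>\<open>L_copy L i j\<close>, \<open>L_bar n L i\<close> and \<open>Lambda_bar n \<Lambda> i\<close> are the paper's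
  $\mathcal{L}_{ij}$, $\bar{\mathcal{L}}_i$ and $\bar{\Lambda}_i$; in the last two the index
  \<open>i = n - 1\<close> gets $n-2$ copies of each symbol, the smaller indices $n$ copies.\<close>

definition L_copy :: "(nat \<Rightarrow> 'a set) \<Rightarrow> nat \<Rightarrow> nat \<Rightarrow> ('a \<times> nat) set" where
  "L_copy L i j = {(\<alpha>, j) | \<alpha>. \<alpha> \<in> L i}"

definition L_bar :: "nat \<Rightarrow> (nat \<Rightarrow> 'a set) \<Rightarrow> nat \<Rightarrow> ('a \<times> nat) set" where
  "L_bar n L i = (if i = n - 1 then L i \<times> {1..n - 2} else (\<Union>j\<in>{1..n}. L_copy L i j))"

definition Lambda_bar ::
  "nat \<Rightarrow> (nat \<Rightarrow> nat \<Rightarrow> nat \<Rightarrow> 'a) \<Rightarrow> nat \<Rightarrow> nat \<Rightarrow> nat \<Rightarrow> ('a \<times> nat) set" where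
  "Lambda_bar n \<Lambda> i = inflation (if i = n - 1 then n - 2 else n) (\<Lambda> i)"

definition superposition ::
  "nat \<Rightarrow> (nat \<Rightarrow> nat \<Rightarrow> nat \<Rightarrow> 'a) \<Rightarrow> nat \<Rightarrow> nat \<Rightarrow> ('a \<times> nat) set" where
  "superposition n \<Lambda> r c = (\<Union>i\<in>{1..n - 1}. Lambda_bar n \<Lambda> i r c)"

text \<open>The symbol from $\mathcal{L}_{tj}$ that is moved out of cell $(i,j)$.\<close>

definition moved_symbol ::
  "nat \<Rightarrow> (nat \<Rightarrow> 'a set) \<Rightarrow> (nat \<Rightarrow> nat \<Rightarrow> nat \<Rightarrow> 'a) \<Rightarrow> nat \<Rightarrow> nat \<Rightarrow> nat \<Rightarrow> 'a \<times> nat" where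
  "moved_symbol n L \<Lambda> t i j = (THE x. x \<in> superposition n \<Lambda> i j \<and> x \<in> L_copy L t j)"

definition S_bar ::
  "nat \<Rightarrow> (nat \<Rightarrow> 'a set) \<Rightarrow> (nat \<Rightarrow> nat \<Rightarrow> nat \<Rightarrow> 'a) \<Rightarrow> nat \<Rightarrow> nat \<Rightarrow> ('a \<times> nat) set" where
  "S_bar n L \<Lambda> r c =
     (if r \<in> {1..n} \<and> c \<in> {1..n} then
        superposition n \<Lambda> r c - {moved_symbol n L \<Lambda> t r c | t. t \<in> {1..n - 2}}
      else if r \<in> {1..n} \<and> c = n + 1 then
        {moved_symbol n L \<Lambda> t r j | t j. t \<in> {1..n - 2} \<and> j \<in> {1..n}}
      else if r = n + 1 \<and> c \<in> {1..n} then
        {moved_symbol n L \<Lambda> t i c | t i. t \<in> {1..n - 2} \<and> i \<in> {1..n}}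
      else if r = n + 1 \<and> c = n + 1 then L_bar n L (n - 1)
      else {})"

text \<open>The description of \<open>moved_symbol\<close> is proper, so its value is the symbol intended.\<close>

lemma ex1_moved_symbol:
  assumes "mutually_orthogonal_latin_squares n {1..n - 1} L \<Lambda>"
    and "disjoint_family_on L {1..n - 1}"
    and t: "t \<in> {1..n - 2}" and ij: "i \<in> {1..n}" "j \<in> {1..n}"
  shows "\<exists>!x. x \<in> superposition n \<Lambda> i j \<and> x \<in> L_copy L t j"
proof -
  have t': "t \<in> {1..n - 1}" "t \<noteq> n - 1" using t by auto
  have mem: "\<Lambda> s i j \<in> L s" if "s \<in> {1..n - 1}" for s
    using assms(1) that ij unfolding mutually_orthogonal_latin_squares_def latin_square_def by blast
  have same: "s = t" if "s \<in> {1..n - 1}" "\<Lambda> s i j \<in> L t" for s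
    using assms(2) that t'(1) mem[OF that(1)] unfolding disjoint_family_on_def by blast
  show ?thesis
  proof (rule ex1I[of _ "(\<Lambda> t i j, j)"])
    show "(\<Lambda> t i j, j) \<in> superposition n \<Lambda> i j \<and> (\<Lambda> t i j, j) \<in> L_copy L t j"
      using t' mem[OF t'(1)] ij
      unfolding superposition_def Lambda_bar_def inflation_def L_copy_def by fastforce
  next
    fix x assume x: "x \<in> superposition n \<Lambda> i j \<and> x \<in> L_copy L t j"
    then obtain s where s: "s \<in> {1..n - 1}" "fst x = \<Lambda> s i j"
      unfolding superposition_def Lambda_bar_def inflation_def by auto
    from x have "snd x = j" "fst x \<in> L t" unfolding L_copy_def by auto
    with s same[of s] show "x = (\<Lambda> t i j, j)" by (metis prod.collapse)
  qed
qed

end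

theory Submission imports Defs begin

text \<open>
  Any $n - 1$ mutually orthogonal Latin squares of order $n$ form a complete set: for two cells in
  different rows and columns exactly one of the squares has the same symbol in both.
  At most one does by orthogonality. For existence, fix the cell $(r,c)$ and a row
  $r' \neq r$; the map sending a square to the column in which its symbol of $(r,c)$ occurs in
  row $r'$ is injective into the $n - 1$ columns other than $c$, hence onto them.
  The common square, inflated, contributes exactly $n - 2$ common treatments to the two blocks of
  $\bar S$: if it is $\Lambda_{n-1}$ then all its $n - 2$ copies, and otherwise the $n$ copies
  except the two moved out.
\<close>

text \<open>The two-parameter comprehensions describing the last column and last row become images,
  so that \<open>image_cong\<close> and \<open>card_image\<close> apply to them.\<close>

lemma Collect_eq_image_Times:
  "{f x y | x y. x \<in> A \<and> y \<in> B} = (\<lambda>(x, y). f x y) ` (A \<times> B)"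
  by force

section \<open>Latin squares with disjoint symbol sets and coincidences between two cells\<close>

locale complete_mols =
  fixes n :: nat and L :: "nat \<Rightarrow> 'a set" and \<Lambda> :: "nat \<Rightarrow> nat \<Rightarrow> nat \<Rightarrow> 'a"
  assumes n_gt_2: "n > 2"
    and mols: "mutually_orthogonal_latin_squares n {1..n - 1} L \<Lambda>"
    and disjoint: "disjoint_family_on L {1..n - 1}"
begin

lemma latin: "t \<in> {1..n - 1} \<Longrightarrow> latin_square n (L t) (\<Lambda> t)"
  using mols unfolding mutually_orthogonal_latin_squares_def by blast

lemma
  assumes "t \<in> {1..n - 1}"
  shows finite_L: "finite (L t)" and card_L: "card (L t) = n"
  using latin[OF assms] unfolding latin_square_def by simp_all

lemma entry_in_L:
  assumes "t \<in> {1..n - 1}" "r \<in> {1..n}" "c \<in> {1..n}"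
  shows "\<Lambda> t r c \<in> L t"
proof -
  have "\<forall>r\<in>{1..n}. \<forall>c\<in>{1..n}. \<Lambda> t r c \<in> L t"
    using latin[OF assms(1)] unfolding latin_square_def by (elim conjE)
  from bspec[OF bspec[OF this assms(2)] assms(3)] show ?thesis .
qed

lemma ex1_column:
  assumes "t \<in> {1..n - 1}" "x \<in> L t" "r \<in> {1..n}"
  shows "\<exists>!c. c \<in> {1..n} \<and> \<Lambda> t r c = x"
proof -
  have "\<forall>x\<in>L t. \<forall>r\<in>{1..n}. \<exists>!c. c \<in> {1..n} \<and> \<Lambda> t r c = x"
    using latin[OF assms(1)] unfolding latin_square_def by (elim conjE)
  from bspec[OF bspec[OF this assms(2)] assms(3)] show ?thesis .
qed

lemma ex1_row:
  assumes "t \<in> {1..n - 1}" "x \<in> L t" "c \<in> {1..n}"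
  shows "\<exists>!r. r \<in> {1..n} \<and> \<Lambda> t r c = x"
proof -
  have "\<forall>x\<in>L t. \<forall>c\<in>{1..n}. \<exists>!r. r \<in> {1..n} \<and> \<Lambda> t r c = x"
    using latin[OF assms(1)] unfolding latin_square_def by (elim conjE)
  from bspec[OF bspec[OF this assms(2)] assms(3)] show ?thesis .
qed

lemma same_row_eq:
  "t \<in> {1..n - 1} \<Longrightarrow> r \<in> {1..n} \<Longrightarrow> c \<in> {1..n} \<Longrightarrow> c' \<in> {1..n} \<Longrightarrow>
    \<Lambda> t r c = \<Lambda> t r c' \<longleftrightarrow> c = c'"
  using ex1_column[of t "\<Lambda> t r c" r] entry_in_L[of t r c] by metis

lemma same_column_eq:
  "t \<in> {1..n - 1} \<Longrightarrow> r \<in> {1..n} \<Longrightarrow> r' \<in> {1..n} \<Longrightarrow> c \<in> {1..n} \<Longrightarrow>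
    \<Lambda> t r c = \<Lambda> t r' c \<longleftrightarrow> r = r'"
  using ex1_row[of t "\<Lambda> t r c" c] entry_in_L[of t r c] by metis

lemma index_unique:
  "s \<in> {1..n - 1} \<Longrightarrow> t \<in> {1..n - 1} \<Longrightarrow> x \<in> L s \<Longrightarrow> x \<in> L t \<Longrightarrow> s = t"
  using disjoint unfolding disjoint_family_on_def by blast

text \<open>Since the symbol sets are disjoint, a symbol determines the square it comes from,
  whatever cells are compared.\<close>

lemma entry_index_unique:
  assumes "s \<in> {1..n - 1}" "t \<in> {1..n - 1}" "r \<in> {1..n}" "c \<in> {1..n}"
    "r' \<in> {1..n}" "c' \<in> {1..n}" "\<Lambda> s r c = \<Lambda> t r' c'"
  shows "s = t"
  using assms index_unique entry_in_L by metis

text \<open>If s and t were different, the pair of symbols that the two squares show in (r, c) would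
  occur again in (r', c'), against orthogonality.\<close>

lemma at_most_one_coincidence:
  assumes s: "s \<in> {1..n - 1}" and t: "t \<in> {1..n - 1}"
    and cells: "r \<in> {1..n}" "c \<in> {1..n}" "r' \<in> {1..n}" "c' \<in> {1..n}" and "r \<noteq> r'"
    and eq: "\<Lambda> s r c = \<Lambda> s r' c'" "\<Lambda> t r c = \<Lambda> t r' c'"
  shows "s = t"
proof (rule ccontr)
  assume "s \<noteq> t"
  then have "orthogonal_squares n (L s) (L t) (\<Lambda> s) (\<Lambda> t)"
    using mols s t unfolding mutually_orthogonal_latin_squares_def by blast
  then have "\<exists>!p. p \<in> {1..n} \<times> {1..n} \<and> \<Lambda> s (fst p) (snd p) = \<Lambda> s r c
      \<and> \<Lambda> t (fst p) (snd p) = \<Lambda> t r c"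
    unfolding orthogonal_squares_def
    by (rule bspec[OF bspec[OF _ entry_in_L[OF s cells(1,2)]] entry_in_L[OF t cells(1,2)]])
  then have "(r, c) = (r', c')"
    by (rule ex1E) (use cells eq in \<open>metis fst_conv snd_conv mem_Sigma_iff\<close>)
  with \<open>r \<noteq> r'\<close> show False by simp
qed

lemma ex_coincidence:
  assumes cells: "r \<in> {1..n}" "c \<in> {1..n}" "r' \<in> {1..n}" "c' \<in> {1..n}"
    and "r \<noteq> r'" "c \<noteq> c'"
  shows "\<exists>s\<in>{1..n - 1}. \<Lambda> s r c = \<Lambda> s r' c'"
proof -
  have "\<forall>s\<in>{1..n - 1}. \<exists>d. d \<in> {1..n} \<and> \<Lambda> s r' d = \<Lambda> s r c"
    using ex1_column[OF _ entry_in_L[OF _ cells(1,2)] cells(3)] by (intro ballI ex1_implies_ex)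
  then obtain f where f: "\<And>s. s \<in> {1..n - 1} \<Longrightarrow> f s \<in> {1..n} \<and> \<Lambda> s r' (f s) = \<Lambda> s r c"
    by metis
  \<comment> \<open>Column c of \<open>\<Lambda> s\<close> already has the symbol of (r, c) in row
    r, so in row r' that symbol stands elsewhere.\<close>
  have "f s \<in> {1..n} - {c}" if s: "s \<in> {1..n - 1}" for s
  proof -
    have "f s \<noteq> c"
      using f[OF s] same_column_eq[OF s cells(1,3,2)] \<open>r \<noteq> r'\<close> by auto
    with f[OF s] show ?thesis by simp
  qed
  then have "f ` {1..n - 1} \<subseteq> {1..n} - {c}" by blast
  \<comment> \<open>A common value d of f at s and t makes both squares agree on the cells (r, c)
    and (r', d).\<close>
  moreover have "inj_on f {1..n - 1}"
  proof (rule inj_onI)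
    fix s t assume s: "s \<in> {1..n - 1}" and t: "t \<in> {1..n - 1}" and "f s = f t"
    with f[OF s] f[OF t] show "s = t"
      using at_most_one_coincidence[OF s t cells(1,2,3) _ \<open>r \<noteq> r'\<close>, of "f s"] by simp
  qed
  moreover have "card ({1..n} - {c}) = card {1..n - 1}"
    using cells by simp
  ultimately have "f ` {1..n - 1} = {1..n} - {c}"
    by (intro card_subset_eq) (simp_all add: card_image)
  with cells \<open>c \<noteq> c'\<close> have "c' \<in> f ` {1..n - 1}" by simp
  with f show ?thesis by force
qed

section \<open>Closed forms of the cells of \<open>S_bar\<close>\<close>

lemma small_index: "t \<in> {1..n - 2} \<Longrightarrow> t \<in> {1..n - 1}" "t \<in> {1..n - 2} \<Longrightarrow> t \<noteq> n - 1"
  by auto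

lemma last_index: "n - 1 \<in> {1..n - 1}"
  using n_gt_2 by auto

lemma superposition_eq:
  "superposition n \<Lambda> r c =
     (\<Union>t\<in>{1..n - 2}. {\<Lambda> t r c} \<times> {1..n}) \<union> {\<Lambda> (n - 1) r c} \<times> {1..n - 2}"
proof -
  have "{1..n - 1} = insert (n - 1) {1..n - 2}" using n_gt_2 by auto
  moreover have "Lambda_bar n \<Lambda> t r c = {\<Lambda> t r c} \<times> {1..n}" if "t \<in> {1..n - 2}" for t
    using small_index(2)[OF that] unfolding Lambda_bar_def inflation_def by auto
  moreover have "Lambda_bar n \<Lambda> (n - 1) r c = {\<Lambda> (n - 1) r c} \<times> {1..n - 2}"
    unfolding Lambda_bar_def inflation_def by auto
  ultimately show ?thesis unfolding superposition_def by auto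
qed

text \<open>The copy that leaves cell (i, j) carries the column number j as its label. Uniqueness
  comes from \<open>ex1_moved_symbol\<close>, so only membership is checked.\<close>

lemma moved_symbol_eq:
  assumes t: "t \<in> {1..n - 2}" and ij: "i \<in> {1..n}" "j \<in> {1..n}"
  shows "moved_symbol n L \<Lambda> t i j = (\<Lambda> t i j, j)"
  unfolding moved_symbol_def
proof (rule the1_equality[OF ex1_moved_symbol[OF mols disjoint t ij]])
  show "(\<Lambda> t i j, j) \<in> superposition n \<Lambda> i j \<and> (\<Lambda> t i j, j) \<in> L_copy L t j"
    using t ij entry_in_L[OF small_index(1)[OF t] ij]
    unfolding superposition_eq L_copy_def by blast
qed

lemma S_bar_inner:
  assumes r: "r \<in> {1..n}" and c: "c \<in> {1..n}"
  shows "S_bar n L \<Lambda> r c =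
    (\<Union>t\<in>{1..n - 2}. {\<Lambda> t r c} \<times> ({1..n} - {c})) \<union> {\<Lambda> (n - 1) r c} \<times> {1..n - 2}"
proof -
  have "{moved_symbol n L \<Lambda> t r c | t. t \<in> {1..n - 2}} = (\<lambda>t. (\<Lambda> t r c, c)) ` {1..n - 2}"
    using moved_symbol_eq[OF _ r c] by force
  \<comment> \<open>Hence removing the moved symbols leaves the copies from the last square
    untouched, even the one labelled c.\<close>
  moreover have "\<Lambda> t r c \<noteq> \<Lambda> (n - 1) r c" if "t \<in> {1..n - 2}" for t
    using entry_index_unique[OF small_index(1)[OF that] last_index r c r c] small_index(2)[OF that]
    by blast
  ultimately show ?thesis
    using r c unfolding S_bar_def superposition_eq by auto
qed

text \<open>With one quantifier over all squares, \<open>card_inner_inner\<close> can handle the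
  common square uniformly and single out the last one only when counting copies.\<close>

lemma mem_S_bar_inner_iff:
  assumes r: "r \<in> {1..n}" and c: "c \<in> {1..n}"
  shows "(x, l) \<in> S_bar n L \<Lambda> r c \<longleftrightarrow>
    (\<exists>u\<in>{1..n - 1}. x = \<Lambda> u r c \<and> l \<in> (if u = n - 1 then {1..n - 2} else {1..n} - {c}))"
proof -
  have "{1..n - 1} = insert (n - 1) {1..n - 2}" using n_gt_2 by auto
  moreover have "(if u = n - 1 then {1..n - 2} else {1..n} - {c}) = {1..n} - {c}"
    if "u \<in> {1..n - 2}" for u
    using small_index(2)[OF that] by simp
  ultimately show ?thesis
    unfolding S_bar_inner[OF r c] by auto
qed

lemma S_bar_last_column:
  assumes r: "r \<in> {1..n}"
  shows "S_bar n L \<Lambda> r (n + 1) = {(\<Lambda> t r j, j) | t j. t \<in> {1..n - 2} \<and> j \<in> {1..n}}"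
proof -
  have "S_bar n L \<Lambda> r (n + 1) = {moved_symbol n L \<Lambda> t r j | t j. t \<in> {1..n - 2} \<and> j \<in> {1..n}}"
    using r unfolding S_bar_def by simp
  also have "\<dots> = (\<lambda>(t, j). (\<Lambda> t r j, j)) ` ({1..n - 2} \<times> {1..n})"
    unfolding Collect_eq_image_Times
    using r by (intro image_cong) (auto simp: moved_symbol_eq)
  finally show ?thesis unfolding Collect_eq_image_Times .
qed

text \<open>All symbols moved into this cell come from column c and so have label c; a column of a
  Latin square contains every symbol, so nothing of \<open>L t\<close> is missed.\<close>

lemma S_bar_last_row:
  assumes c: "c \<in> {1..n}"
  shows "S_bar n L \<Lambda> (n + 1) c = (\<Union>t\<in>{1..n - 2}. L t) \<times> {c}"
proof -
  have "S_bar n L \<Lambda> (n + 1) c = {moved_symbol n L \<Lambda> t i c | t i. t \<in> {1..n - 2} \<and> i \<in> {1..n}}"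
    using c unfolding S_bar_def by simp
  also have "\<dots> = (\<lambda>(t, i). (\<Lambda> t i c, c)) ` ({1..n - 2} \<times> {1..n})"
    unfolding Collect_eq_image_Times
    using c by (intro image_cong) (auto simp: moved_symbol_eq)
  also have "\<dots> = (\<Union>t\<in>{1..n - 2}. (\<lambda>i. \<Lambda> t i c) ` {1..n}) \<times> {c}"
    by auto
  also have "\<dots> = (\<Union>t\<in>{1..n - 2}. L t) \<times> {c}"
  proof -
    have "(\<lambda>i. \<Lambda> t i c) ` {1..n} = L t" if t: "t \<in> {1..n - 2}" for t
    proof (intro equalityI subsetI)
      fix x assume "x \<in> L t"
      then obtain i where "i \<in> {1..n}" "\<Lambda> t i c = x"
        using ex1_row[OF small_index(1)[OF t] _ c] by metis
      then show "x \<in> (\<lambda>i. \<Lambda> t i c) ` {1..n}" by blast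
    qed (use entry_in_L[OF small_index(1)[OF t] _ c] in blast)
    then show ?thesis by simp
  qed
  finally show ?thesis .
qed

lemma S_bar_corner: "S_bar n L \<Lambda> (n + 1) (n + 1) = L (n - 1) \<times> {1..n - 2}"
  unfolding S_bar_def L_bar_def by simp

lemma treatments_eq:
  "(\<Union>i\<in>{1..n - 1}. L_bar n L i) =
     (\<Union>t\<in>{1..n - 2}. L t) \<times> {1..n} \<union> L (n - 1) \<times> {1..n - 2}"
proof -
  have "{1..n - 1} = insert (n - 1) {1..n - 2}" using n_gt_2 by auto
  moreover have "L_bar n L t = L t \<times> {1..n}" if "t \<in> {1..n - 2}" for t
    using small_index(2)[OF that] unfolding L_bar_def L_copy_def by auto
  moreover have "L_bar n L (n - 1) = L (n - 1) \<times> {1..n - 2}"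
    unfolding L_bar_def by simp
  ultimately show ?thesis by auto
qed

section \<open>Block sizes and the treatment set\<close>

lemma finite_Union_L: "finite (\<Union>t\<in>{1..n - 2}. L t)"
  using finite_L small_index(1) by blast

lemma card_Union_L: "card (\<Union>t\<in>{1..n - 2}. L t) = (n - 2) * n"
proof -
  have "card (\<Union>t\<in>{1..n - 2}. L t) = (\<Sum>t\<in>{1..n - 2}. card (L t))"
    using finite_L small_index(1) index_unique by (intro card_UN_disjoint) blast+
  also have "\<dots> = (\<Sum>t\<in>{1..n - 2}. n)"
    using card_L small_index(1) by (intro sum.cong) blast+
  finally show ?thesis by simp
qed

lemma Union_L_disjoint_last: "(\<Union>t\<in>{1..n - 2}. L t) \<inter> L (n - 1) = {}"
  using index_unique[OF last_index] small_index by blast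

lemma inj_on_entry:
  assumes "r \<in> {1..n}" "c \<in> {1..n}"
  shows "inj_on (\<lambda>t. \<Lambda> t r c) {1..n - 1}"
  using entry_index_unique assms by (intro inj_onI) blast

lemma inj_on_entry_pair:
  assumes "r \<in> {1..n}" "c \<in> {1..n}"
  shows "inj_on (\<lambda>t. (\<Lambda> t r c, f t)) {1..n - 2}"
  using inj_on_entry[OF assms] small_index(1) unfolding inj_on_def by blast

text \<open>Each of the first n - 2 squares keeps n - 1 copies of its symbol and the last square
  gives n - 2 copies, in total (n - 2) * (n - 1) + (n - 2).\<close>

lemma card_S_bar_inner:
  assumes r: "r \<in> {1..n}" and c: "c \<in> {1..n}"
  shows "card (S_bar n L \<Lambda> r c) = (n - 2) * n"
proof -
  have "S_bar n L \<Lambda> r c =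
      (\<lambda>t. \<Lambda> t r c) ` {1..n - 2} \<times> ({1..n} - {c}) \<union> {\<Lambda> (n - 1) r c} \<times> {1..n - 2}"
    unfolding S_bar_inner[OF r c] by auto
  moreover have "card ((\<lambda>t. \<Lambda> t r c) ` {1..n - 2}) = n - 2"
    using inj_on_subset[OF inj_on_entry[OF r c]] small_index(1) by (subst card_image) auto
  moreover have "((\<lambda>t. \<Lambda> t r c) ` {1..n - 2}) \<inter> {\<Lambda> (n - 1) r c} = {}"
    using entry_index_unique[OF _ last_index r c r c] small_index by blast
  ultimately have "card (S_bar n L \<Lambda> r c) = (n - 2) * (n - 1) + (n - 2)"
    using c by (simp add: card_Un_disjoint card_cartesian_product Times_Int_Times)
  also have "\<dots> = (n - 2) * (n - 1 + 1)" by simp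
  finally show ?thesis using n_gt_2 by simp
qed

lemma card_S_bar_last_column:
  assumes r: "r \<in> {1..n}"
  shows "card (S_bar n L \<Lambda> r (n + 1)) = (n - 2) * n"
proof -
  \<comment> \<open>The label returns j, and disjointness of the symbol sets returns t.\<close>
  have "inj_on (\<lambda>(t, j). (\<Lambda> t r j, j)) ({1..n - 2} \<times> {1..n})"
    using entry_index_unique[OF small_index(1) small_index(1) r _ r]
    by (intro inj_onI) (clarify, blast)
  then show ?thesis
    unfolding S_bar_last_column[OF r] Collect_eq_image_Times by (simp add: card_image card_cartesian_product)
qed

lemma card_S_bar:
  assumes "r \<in> {1..n + 1}" "c \<in> {1..n + 1}"
  shows "card (S_bar n L \<Lambda> r c) = (n - 2) * n"
proof -
  have "r \<in> {1..n} \<or> r = n + 1" "c \<in> {1..n} \<or> c = n + 1" using assms by auto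
  then show ?thesis
    using card_S_bar_inner card_S_bar_last_column S_bar_last_row S_bar_corner
      card_Union_L card_L[OF last_index]
    by (auto simp: card_cartesian_product)
qed

lemma S_bar_subset:
  assumes "r \<in> {1..n + 1}" "c \<in> {1..n + 1}"
  shows "S_bar n L \<Lambda> r c \<subseteq> (\<Union>i\<in>{1..n - 1}. L_bar n L i)"
proof -
  consider "r \<in> {1..n}" "c \<in> {1..n}" | "r \<in> {1..n}" "c = n + 1"
    | "r = n + 1" "c \<in> {1..n}" | "r = n + 1" "c = n + 1" using assms by force
  then show ?thesis
  proof cases
    case 1
    then show ?thesis unfolding treatments_eq S_bar_inner[OF 1]
      using entry_in_L small_index(1) last_index by blast
  next
    case 2
    have "(\<Lambda> t r j, j) \<in> (\<Union>t\<in>{1..n - 2}. L t) \<times> {1..n}"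
      if "t \<in> {1..n - 2}" "j \<in> {1..n}" for t j
      using entry_in_L[OF small_index(1)[OF that(1)] 2(1) that(2)] that by blast
    then show ?thesis unfolding treatments_eq 2(2) S_bar_last_column[OF 2(1)] by blast
  next
    case 3
    then show ?thesis unfolding treatments_eq 3(1) S_bar_last_row[OF 3(2)] by blast
  next
    case 4
    then show ?thesis unfolding treatments_eq 4 S_bar_corner by blast
  qed
qed

lemma finite_treatments: "finite (\<Union>i\<in>{1..n - 1}. L_bar n L i)"
  unfolding treatments_eq using finite_Union_L finite_L[OF last_index] by simp

lemma card_treatments: "card (\<Union>i\<in>{1..n - 1}. L_bar n L i) = (n + 1) * ((n - 2) * n)"
proof -
  have "((\<Union>t\<in>{1..n - 2}. L t) \<times> {1..n}) \<inter> (L (n - 1) \<times> {1..n - 2}) = {}"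
    using Union_L_disjoint_last by blast
  then have "card (\<Union>i\<in>{1..n - 1}. L_bar n L i) =
      card ((\<Union>t\<in>{1..n - 2}. L t) \<times> {1..n}) + card (L (n - 1) \<times> {1..n - 2})"
    unfolding treatments_eq
    by (intro card_Un_disjoint finite_cartesian_product finite_Union_L finite_L[OF last_index])
      simp_all
  also have "\<dots> = (n - 2) * n * n + n * (n - 2)"
    unfolding card_cartesian_product card_Union_L card_L[OF last_index] by simp
  finally show ?thesis by (simp add: add_mult_distrib add_mult_distrib2 mult_ac)
qed

section \<open>Occurrence of each treatment once in every row and column\<close>

text \<open>Copy l of x follows x in \<open>\<Lambda> t\<close> except in column l. The occurrence
  in column l is the one moved: it reappears in the last column in its own row, and in the last row
  in column l.\<close>

lemma small_treatment_mem_iff: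
  assumes t: "t \<in> {1..n - 2}" and x: "x \<in> L t" and l: "l \<in> {1..n}"
  shows "r \<in> {1..n} \<Longrightarrow> c \<in> {1..n} \<Longrightarrow> (x, l) \<in> S_bar n L \<Lambda> r c \<longleftrightarrow> \<Lambda> t r c = x \<and> c \<noteq> l"
    and "r \<in> {1..n} \<Longrightarrow> (x, l) \<in> S_bar n L \<Lambda> r (n + 1) \<longleftrightarrow> \<Lambda> t r l = x"
    and "c \<in> {1..n} \<Longrightarrow> (x, l) \<in> S_bar n L \<Lambda> (n + 1) c \<longleftrightarrow> c = l"
    and "(x, l) \<notin> S_bar n L \<Lambda> (n + 1) (n + 1)"
proof -
  have idx: "s = t" if "s \<in> {1..n - 1}" "r \<in> {1..n}" "c \<in> {1..n}" "x = \<Lambda> s r c" for s r c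
    using index_unique[OF that(1) small_index(1)[OF t] _ x] entry_in_L[OF that(1-3)] that(4) by simp
  show "(x, l) \<in> S_bar n L \<Lambda> r c \<longleftrightarrow> \<Lambda> t r c = x \<and> c \<noteq> l" if rc: "r \<in> {1..n}" "c \<in> {1..n}"
    unfolding S_bar_inner[OF rc]
    using idx[OF small_index(1) rc] idx[OF last_index rc] t l small_index(2)[OF t] by blast
  show "(x, l) \<in> S_bar n L \<Lambda> r (n + 1) \<longleftrightarrow> \<Lambda> t r l = x" if r: "r \<in> {1..n}"
    unfolding S_bar_last_column[OF r] using idx[OF small_index(1) r l] t l by force
  show "(x, l) \<in> S_bar n L \<Lambda> (n + 1) c \<longleftrightarrow> c = l" if c: "c \<in> {1..n}"
    unfolding S_bar_last_row[OF c] using t x by blast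
  show "(x, l) \<notin> S_bar n L \<Lambda> (n + 1) (n + 1)"
    unfolding S_bar_corner using Union_L_disjoint_last t x by blast
qed

text \<open>Copies from the last square never move, so the corner alone has to supply them to the
  new row and the new column.\<close>

lemma last_treatment_mem_iff:
  assumes x: "x \<in> L (n - 1)" and l: "l \<in> {1..n - 2}"
  shows "r \<in> {1..n} \<Longrightarrow> c \<in> {1..n} \<Longrightarrow> (x, l) \<in> S_bar n L \<Lambda> r c \<longleftrightarrow> \<Lambda> (n - 1) r c = x"
    and "r \<in> {1..n} \<Longrightarrow> (x, l) \<notin> S_bar n L \<Lambda> r (n + 1)"
    and "c \<in> {1..n} \<Longrightarrow> (x, l) \<notin> S_bar n L \<Lambda> (n + 1) c"
    and "(x, l) \<in> S_bar n L \<Lambda> (n + 1) (n + 1)"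
proof -
  have neq: "x \<noteq> \<Lambda> s r c" if "s \<in> {1..n - 2}" "r \<in> {1..n}" "c \<in> {1..n}" for s r c
    using Union_L_disjoint_last x entry_in_L[OF small_index(1)[OF that(1)] that(2,3)] that(1)
    by blast
  show "(x, l) \<in> S_bar n L \<Lambda> r c \<longleftrightarrow> \<Lambda> (n - 1) r c = x" if rc: "r \<in> {1..n}" "c \<in> {1..n}"
    unfolding S_bar_inner[OF rc] using neq[OF _ rc] l by blast
  show "(x, l) \<notin> S_bar n L \<Lambda> r (n + 1)" if r: "r \<in> {1..n}"
    unfolding S_bar_last_column[OF r] using neq[OF _ r] by force
  show "(x, l) \<notin> S_bar n L \<Lambda> (n + 1) c" if c: "c \<in> {1..n}"
    unfolding S_bar_last_row[OF c] using Union_L_disjoint_last x by blast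
  show "(x, l) \<in> S_bar n L \<Lambda> (n + 1) (n + 1)"
    unfolding S_bar_corner using x l by blast
qed

lemma extended_range: "{1..n + 1} = insert (n + 1) {1..n}"
  by auto

lemma ball_extended: "(\<forall>r\<in>{1..n + 1}. P r) \<longleftrightarrow> (\<forall>r\<in>{1..n}. P r) \<and> P (n + 1)"
  unfolding extended_range by blast

lemma ex1_extended:
  "(\<exists>!c. c \<in> {1..n + 1} \<and> P c) \<longleftrightarrow>
    (\<exists>!c. c \<in> {1..n} \<and> P c) \<and> \<not> P (n + 1) \<or> (\<forall>c\<in>{1..n}. \<not> P c) \<and> P (n + 1)"
proof -
  have "n + 1 \<notin> {1..n}" by simp
  then show ?thesis
    unfolding extended_range by (cases "P (n + 1)") blast+
qed

lemma treatment_in_rows_and_columns: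
  assumes "p \<in> (\<Union>i\<in>{1..n - 1}. L_bar n L i)"
  shows "(\<forall>r\<in>{1..n + 1}. \<exists>!c. c \<in> {1..n + 1} \<and> p \<in> S_bar n L \<Lambda> r c)
    \<and> (\<forall>c\<in>{1..n + 1}. \<exists>!r. r \<in> {1..n + 1} \<and> p \<in> S_bar n L \<Lambda> r c)"
proof -
  from assms consider
    (small) t x l where "t \<in> {1..n - 2}" "x \<in> L t" "l \<in> {1..n}" "p = (x, l)"
    | (last) x l where "x \<in> L (n - 1)" "l \<in> {1..n - 2}" "p = (x, l)"
    unfolding treatments_eq by blast
  then show ?thesis
  proof cases
    case small
    note mem = small_treatment_mem_iff[OF small(1-3)]
    have col: "\<exists>!c. c \<in> {1..n} \<and> \<Lambda> t r c = x" if "r \<in> {1..n}" for r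
      using ex1_column[OF small_index(1)[OF small(1)] small(2) that] .
    have row: "\<exists>!r. r \<in> {1..n} \<and> \<Lambda> t r c = x" if "c \<in> {1..n}" for c
      using ex1_row[OF small_index(1)[OF small(1)] small(2) that] .
    \<comment> \<open>In \<open>\<Lambda> t\<close> the symbol x has one column in row r; the
      treatment is there, or in column n + 1 if that column is l.\<close>
    have "\<exists>!c. c \<in> {1..n + 1} \<and> p \<in> S_bar n L \<Lambda> r c" if r: "r \<in> {1..n}" for r
      unfolding small(4) ex1_extended using col[OF r] mem(1)[OF r] mem(2)[OF r] small(3) by metis
    moreover have "\<exists>!c. c \<in> {1..n + 1} \<and> p \<in> S_bar n L \<Lambda> (n + 1) c"
      unfolding small(4) ex1_extended using mem(3,4) small(3) by metis
    \<comment> \<open>Column l has lost this copy in all of the first n rows and regains it in row n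
      + 1; any other column keeps it where \<open>\<Lambda> t\<close> has x.\<close>
    moreover have "\<exists>!r. r \<in> {1..n + 1} \<and> p \<in> S_bar n L \<Lambda> r c" if c: "c \<in> {1..n}" for c
      unfolding small(4) ex1_extended using row[OF c] mem(1)[OF _ c] mem(3)[OF c]
      by (cases "c = l") (simp_all cong: conj_cong)
    moreover have "\<exists>!r. r \<in> {1..n + 1} \<and> p \<in> S_bar n L \<Lambda> r (n + 1)"
      unfolding small(4) ex1_extended using row[OF small(3)] mem(2,4)
      by (simp cong: conj_cong)
    ultimately show ?thesis unfolding ball_extended by simp
  next
    case last
    note mem = last_treatment_mem_iff[OF last(1,2)]
    have "\<exists>!c. c \<in> {1..n + 1} \<and> p \<in> S_bar n L \<Lambda> r c" if r: "r \<in> {1..n}" for r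
      unfolding last(3) ex1_extended
      using ex1_column[OF last_index last(1) r] mem(1)[OF r] mem(2)[OF r] by metis
    moreover have "\<exists>!c. c \<in> {1..n + 1} \<and> p \<in> S_bar n L \<Lambda> (n + 1) c"
      unfolding last(3) ex1_extended using mem(3,4) by metis
    moreover have "\<exists>!r. r \<in> {1..n + 1} \<and> p \<in> S_bar n L \<Lambda> r c" if c: "c \<in> {1..n}" for c
      unfolding last(3) ex1_extended
      using ex1_row[OF last_index last(1) c] mem(1)[OF _ c] mem(3)[OF c] by metis
    moreover have "\<exists>!r. r \<in> {1..n + 1} \<and> p \<in> S_bar n L \<Lambda> r (n + 1)"
      unfolding last(3) ex1_extended using mem(2,4) by metis
    ultimately show ?thesis unfolding ball_extended by simp
  qed
qed

lemma semi_latin_S_bar: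
  "semi_latin_square (n + 1) ((n - 2) * n) (\<Union>i\<in>{1..n - 1}. L_bar n L i) (S_bar n L \<Lambda>)"
  unfolding semi_latin_square_def
  by (intro conjI ballI finite_treatments card_treatments S_bar_subset card_S_bar
      treatment_in_rows_and_columns[THEN conjunct1, THEN bspec]
      treatment_in_rows_and_columns[THEN conjunct2, THEN bspec])
    (use n_gt_2 in simp_all)

section \<open>Intersections of blocks, by the positions of the two cells\<close>

lemma card_entry_image:
  assumes "r \<in> {1..n}" "c \<in> {1..n}"
  shows "card ((\<lambda>t. (\<Lambda> t r c, f t)) ` {1..n - 2}) = n - 2"
  using card_image[OF inj_on_entry_pair[OF assms]] by simp

lemma card_inner_inner:
  assumes r: "r \<in> {1..n}" and c: "c \<in> {1..n}" and r': "r' \<in> {1..n}" and c': "c' \<in> {1..n}"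
    and neq: "r \<noteq> r'" "c \<noteq> c'"
  shows "card (S_bar n L \<Lambda> r c \<inter> S_bar n L \<Lambda> r' c') = n - 2"
proof -
  obtain s where s: "s \<in> {1..n - 1}" "\<Lambda> s r c = \<Lambda> s r' c'"
    using ex_coincidence[OF r c r' c' neq] by blast
  \<comment> \<open>A common treatment has a symbol from square u in one cell and square v in the
    other. Disjointness gives u = v, and a second coincidence besides s is impossible.\<close>
  have coincide: "u = s \<and> v = s"
    if "u \<in> {1..n - 1}" "v \<in> {1..n - 1}" "\<Lambda> u r c = \<Lambda> v r' c'" for u v
    using entry_index_unique[OF that(1,2) r c r' c' that(3)] that
      at_most_one_coincidence[OF that(1) s(1) r c r' c' neq(1) _ s(2)] by blast
  let ?copies = "\<lambda>c. if s = n - 1 then {1..n - 2} else {1..n} - {c}"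
  have "S_bar n L \<Lambda> r c \<inter> S_bar n L \<Lambda> r' c' = {\<Lambda> s r c} \<times> (?copies c \<inter> ?copies c')"
    (is "?l = ?r")
  proof (intro equalityI subrelI)
    fix x l assume "(x, l) \<in> ?l"
    then obtain u v where u: "u \<in> {1..n - 1}" "x = \<Lambda> u r c"
        "l \<in> (if u = n - 1 then {1..n - 2} else {1..n} - {c})"
      and v: "v \<in> {1..n - 1}" "x = \<Lambda> v r' c'"
        "l \<in> (if v = n - 1 then {1..n - 2} else {1..n} - {c'})"
      unfolding Int_iff mem_S_bar_inner_iff[OF r c] mem_S_bar_inner_iff[OF r' c'] by blast
    have "u = s" "v = s" using coincide[OF u(1) v(1)] u(2) v(2) by simp_all
    with u v show "(x, l) \<in> ?r" by blast
  next
    fix x l assume "(x, l) \<in> ?r"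
    then have "x = \<Lambda> s r c" "l \<in> ?copies c" "l \<in> ?copies c'" by blast+
    with s show "(x, l) \<in> ?l"
      unfolding Int_iff mem_S_bar_inner_iff[OF r c] mem_S_bar_inner_iff[OF r' c'] by metis
  qed
  moreover have "card (?copies c \<inter> ?copies c') = n - 2"
  proof (cases "s = n - 1")
    case False
    \<comment> \<open>One cell has lost label c and the other label c', which differ, so n - 2
      labels remain.\<close>
    then have "?copies c \<inter> ?copies c' = {1..n} - {c, c'}" by auto
    then show ?thesis using c c' neq by (simp add: card_Diff_subset)
  qed simp
  ultimately show ?thesis unfolding card_cartesian_product by simp
qed

text \<open>Each of the first n - 2 squares contributes one common treatment: its symbol in (r, c),
  labelled by the column where row r' of that square contains this symbol.\<close>

lemma card_inner_last_column:
  assumes r: "r \<in> {1..n}" and c: "c \<in> {1..n}" and r': "r' \<in> {1..n}" and neq: "r \<noteq> r'"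
  shows "card (S_bar n L \<Lambda> r c \<inter> S_bar n L \<Lambda> r' (n + 1)) = n - 2"
proof -
  have "\<forall>t\<in>{1..n - 2}. \<exists>d. d \<in> {1..n} \<and> \<Lambda> t r' d = \<Lambda> t r c"
    using ex1_column[OF small_index(1) entry_in_L[OF small_index(1) r c] r']
    by (intro ballI ex1_implies_ex)
  then obtain f where f: "\<And>t. t \<in> {1..n - 2} \<Longrightarrow> f t \<in> {1..n} \<and> \<Lambda> t r' (f t) = \<Lambda> t r c"
    by metis
  have "S_bar n L \<Lambda> r c \<inter> S_bar n L \<Lambda> r' (n + 1) = (\<lambda>t. (\<Lambda> t r c, f t)) ` {1..n - 2}"
    (is "?l = ?r")
  proof (intro equalityI subsetI)
    fix p assume p: "p \<in> ?l"
    then obtain t l where t: "t \<in> {1..n - 2}" and l: "l \<in> {1..n}" and pe: "p = (\<Lambda> t r' l, l)"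
      unfolding S_bar_last_column[OF r'] by blast
    from p pe have "\<Lambda> t r c = \<Lambda> t r' l"
      using small_treatment_mem_iff(1)[OF t entry_in_L[OF small_index(1)[OF t] r' l] l r c] by blast
    moreover from this have "\<Lambda> t r' l = \<Lambda> t r' (f t)"
      using f[OF t] by (elim conjE) (rule trans[OF sym sym])
    then have "l = f t"
      using f[OF t] same_row_eq[OF small_index(1)[OF t] r' l, of "f t"] by blast
    ultimately have "p = (\<Lambda> t r c, f t)" using pe by simp
    with t show "p \<in> ?r" by blast
  next
    fix p assume "p \<in> ?r"
    then obtain t where t: "t \<in> {1..n - 2}" and pe: "p = (\<Lambda> t r c, f t)" by blast
    \<comment> \<open>Only the copy labelled c was removed from (r, c), so the copy labelled
      \<open>f t\<close> is still there.\<close>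
    have "c \<noteq> f t"
      using f[OF t] same_column_eq[OF small_index(1)[OF t] r r' c] neq by auto
    then show "p \<in> ?l"
      using small_treatment_mem_iff(1,2)[OF t entry_in_L[OF small_index(1)[OF t] r c]] f[OF t]
        r c r' pe by simp
  qed
  then show ?thesis using card_entry_image[OF r c] by simp
qed

text \<open>The last-row block holds label c' only. As c' differs from c, that copy of each of the
  first n - 2 symbols survived in (r, c).\<close>

lemma card_inner_last_row:
  assumes r: "r \<in> {1..n}" and c: "c \<in> {1..n}" and c': "c' \<in> {1..n}" and neq: "c \<noteq> c'"
  shows "card (S_bar n L \<Lambda> r c \<inter> S_bar n L \<Lambda> (n + 1) c') = n - 2"
proof -
  have "\<Lambda> (n - 1) r c \<notin> (\<Union>t\<in>{1..n - 2}. L t)"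
    using Union_L_disjoint_last entry_in_L[OF last_index r c] by blast
  moreover have "\<Lambda> t r c \<in> (\<Union>t\<in>{1..n - 2}. L t)" if "t \<in> {1..n - 2}" for t
    using entry_in_L[OF small_index(1)[OF that] r c] that by blast
  ultimately have "S_bar n L \<Lambda> r c \<inter> S_bar n L \<Lambda> (n + 1) c' = (\<lambda>t. (\<Lambda> t r c, c')) ` {1..n - 2}"
    unfolding S_bar_inner[OF r c] S_bar_last_row[OF c'] using c' neq by blast
  then show ?thesis using card_entry_image[OF r c] by simp
qed

lemma card_inner_corner:
  assumes r: "r \<in> {1..n}" and c: "c \<in> {1..n}"
  shows "card (S_bar n L \<Lambda> r c \<inter> S_bar n L \<Lambda> (n + 1) (n + 1)) = n - 2"
proof -
  have "\<Lambda> (n - 1) r c \<in> L (n - 1)"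
    using entry_in_L[OF last_index r c] .
  moreover have "\<Lambda> t r c \<notin> L (n - 1)" if "t \<in> {1..n - 2}" for t
    using entry_in_L[OF small_index(1)[OF that] r c] that Union_L_disjoint_last by blast
  ultimately have "S_bar n L \<Lambda> r c \<inter> S_bar n L \<Lambda> (n + 1) (n + 1) = {\<Lambda> (n - 1) r c} \<times> {1..n - 2}"
    unfolding S_bar_inner[OF r c] S_bar_corner by blast
  then show ?thesis by (simp add: card_cartesian_product)
qed

text \<open>Among the symbols moved out of row r, those with label c come from cell (r, c); these n
  - 2 symbols were inserted in both blocks.\<close>

lemma card_last_column_last_row:
  assumes r: "r \<in> {1..n}" and c: "c \<in> {1..n}"
  shows "card (S_bar n L \<Lambda> r (n + 1) \<inter> S_bar n L \<Lambda> (n + 1) c) = n - 2"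
proof -
  have "\<Lambda> t r c \<in> (\<Union>t\<in>{1..n - 2}. L t)" if "t \<in> {1..n - 2}" for t
    using entry_in_L[OF small_index(1)[OF that] r c] that by blast
  then have "S_bar n L \<Lambda> r (n + 1) \<inter> S_bar n L \<Lambda> (n + 1) c = (\<lambda>t. (\<Lambda> t r c, c)) ` {1..n - 2}"
    unfolding S_bar_last_column[OF r] S_bar_last_row[OF c] using c by auto
  then show ?thesis using card_entry_image[OF r c] by simp
qed

lemma blocks_meet_S_bar: "blocks_meet_in (n + 1) (n - 2) (S_bar n L \<Lambda>)"
proof -
  have "card (S_bar n L \<Lambda> r c \<inter> S_bar n L \<Lambda> r' c') = n - 2"
    if "r \<in> {1..n + 1}" "c \<in> {1..n + 1}" "r' \<in> {1..n + 1}" "c' \<in> {1..n + 1}"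
      and neq: "r \<noteq> r'" "c \<noteq> c'" for r c r' c'
  proof -
    \<comment> \<open>Up to exchanging the two blocks, the five counting lemmas cover all pairs of
      positions; a corner can only meet an inner cell, as other cells share its row or
      column.\<close>
    have "r \<in> {1..n} \<or> r = n + 1" "c \<in> {1..n} \<or> c = n + 1"
      "r' \<in> {1..n} \<or> r' = n + 1" "c' \<in> {1..n} \<or> c' = n + 1" using that by auto
    then show ?thesis
      using neq card_inner_inner card_inner_last_column card_inner_last_row card_inner_corner
        card_last_column_last_row Int_commute by metis
  qed
  then show ?thesis unfolding blocks_meet_in_def by blast
qed

end

theorem mainTheorem5:
  fixes n :: nat and L :: "nat \<Rightarrow> 'a set" and \<Lambda> :: "nat \<Rightarrow> nat \<Rightarrow> nat \<Rightarrow> 'a"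
  assumes "n > 2"
    and "mutually_orthogonal_latin_squares n {1..n - 1} L \<Lambda>"
    and "disjoint_family_on L {1..n - 1}"
  shows "uniform_semi_latin_square (n + 1) ((n - 2) * n) (\<Union>i\<in>{1..n - 1}. L_bar n L i) (S_bar n L \<Lambda>)
         \<and> blocks_meet_in (n + 1) (n - 2) (S_bar n L \<Lambda>)"
proof -
  interpret complete_mols n L \<Lambda>
    using assms by unfold_locales
  \<comment> \<open>Uniformity demands a positive intersection number.\<close>
  have "n - 2 > 0" using assms(1) by simp
  then show ?thesis
    unfolding uniform_semi_latin_square_def using semi_latin_S_bar blocks_meet_S_bar by blast
qed

end
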